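(* Let $n\in\mathbb N$, $n\ge 1$. The pair $(\mathcal K^n,\mathbb R^n)$ has the $E(n)$-finite extension property.
   Context: $\mathcal K^n$ denotes the family of all (nonempty) compact convex subsets of $\mathbb R^n$, equipped with the Hausdorff metric $d_H(A,B)=\max\{\sup_{b\in B}d(b,A),\sup_{a\in A}d(a,B)\}$, where $d$ is the Euclidean metric. $E(n)$ is the Euclidean group, i.e. the group of all isometries of $\mathbb R^n$ with respect to the Euclidean norm, with its usual topology. It acts naturally on $\mathbb R^n$, and on $\mathcal K^n$ by $gK=\{g(x)\mid x\in K\}$. For a topological group $G$, a $G$-space is a topological space with a continuous action of $G$; $G_x=\{g\in G\mid gx=x\}$ is the stabilizer of $x$ and $G(x)=\{gx\mid g\in G\}$ its orbit. A $G$-map is a continuous function $f$ between $G$-spaces with $f(gx)=gf(x)$ for all $g\in G$ and all $x$. A pair $(X,Y)$ of $G$-spaces has the $G$-finite extension property if for all finite sets $\{x_1,\dots,x_k\}\subset X$ and $\{y_1,\dots,y_k\}\subset Y$ satisfying (1) $G_{x_i}\leq G_{y_i}$ for every $i\in\{1,\dots,k\}$ and (2) $G(x_i)\cap G(x_j)=\emptyset$ if $i\neq j$, there exists a $G$-map $\psi:X\to Y$ such that $\psi(x_i)=y_i$ for every $i\in\{1,\dots,k\}$. *)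

theory Defs
  imports "HOL-Analysis.Analysis" "HOL-Algebra.Group_Action"
begin

section \<open>Topological groups, \<open>G\<close>-spaces and the finite extension property\<close>

definition topological_group :: "('g, 'm) monoid_scheme \<Rightarrow> 'g topology \<Rightarrow> bool" where
  "topological_group G T \<longleftrightarrow>
     group G \<and> topspace T = carrier G \<and>
     continuous_map (prod_topology T T) T (\<lambda>(g, h). g \<otimes>\<^bsub>G\<^esub> h) \<and>
     continuous_map T T (\<lambda>g. inv\<^bsub>G\<^esub> g)"

definition G_space ::
    "('g, 'm) monoid_scheme \<Rightarrow> 'g topology \<Rightarrow> 'x topology \<Rightarrow> ('g \<Rightarrow> 'x \<Rightarrow> 'x) \<Rightarrow> bool" where
  "G_space G T X \<phi> \<longleftrightarrow>
     topological_group G T \<and> group_action G (topspace X) \<phi> \<and>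
     continuous_map (prod_topology T X) X (\<lambda>(g, x). \<phi> g x)"

definition G_map ::
    "('g, 'm) monoid_scheme \<Rightarrow> 'x topology \<Rightarrow> ('g \<Rightarrow> 'x \<Rightarrow> 'x) \<Rightarrow>
     'y topology \<Rightarrow> ('g \<Rightarrow> 'y \<Rightarrow> 'y) \<Rightarrow> ('x \<Rightarrow> 'y) \<Rightarrow> bool" where
  "G_map G X \<phi> Y \<psi> f \<longleftrightarrow>
     continuous_map X Y f \<and>
     (\<forall>g\<in>carrier G. \<forall>x\<in>topspace X. f (\<phi> g x) = \<psi> g (f x))"

text \<open>Being a pair of \<open>G\<close>-spaces is part of the property. The points \<open>y i\<close> may repeat; the
  points \<open>x i\<close> are distinct because their orbits are disjoint.\<close>

definition G_finite_extension_property ::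
    "('g, 'm) monoid_scheme \<Rightarrow> 'g topology \<Rightarrow>
     'x topology \<Rightarrow> ('g \<Rightarrow> 'x \<Rightarrow> 'x) \<Rightarrow> 'y topology \<Rightarrow> ('g \<Rightarrow> 'y \<Rightarrow> 'y) \<Rightarrow> bool" where
  "G_finite_extension_property G T X \<phi> Y \<psi> \<longleftrightarrow>
     G_space G T X \<phi> \<and> G_space G T Y \<psi> \<and>
     (\<forall>(k::nat) (x :: nat \<Rightarrow> 'x) (y :: nat \<Rightarrow> 'y).
        (\<forall>i\<in>{1..k}. x i \<in> topspace X \<and> y i \<in> topspace Y) \<and>
        (\<forall>i\<in>{1..k}. stabilizer G \<phi> (x i) \<subseteq> stabilizer G \<psi> (y i)) \<and>
        (\<forall>i\<in>{1..k}. \<forall>j\<in>{1..k}. i \<noteq> j \<longrightarrow> orbit G \<phi> (x i) \<inter> orbit G \<phi> (x j) = {})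
        \<longrightarrow> (\<exists>f. G_map G X \<phi> Y \<psi> f \<and> (\<forall>i\<in>{1..k}. f (x i) = y i)))"


section \<open>The hyperspace of compact convex sets\<close>

definition compact_convex_sets :: "(real ^ 'n) set set" where
  "compact_convex_sets = {K. K \<noteq> {} \<and> compact K \<and> convex K}"

text \<open>Outside \<open>compact_convex_sets\<close> the value is set to \<open>0\<close>, because \<^locale>\<open>Metric_space\<close> demands a
  symmetric non-negative function on the whole type and the suprema below are unspecified for
  unbounded sets.\<close>

definition hausdorff_dist :: "(real ^ 'n) set \<Rightarrow> (real ^ 'n) set \<Rightarrow> real" where
  "hausdorff_dist A B =
     (if A \<in> compact_convex_sets \<and> B \<in> compact_convex_sets
      then max (SUP b\<in>B. infdist b A) (SUP a\<in>A. infdist a B) else 0)"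

lemma hausdorff_dist_le_iff:
  assumes "A \<in> compact_convex_sets" "B \<in> compact_convex_sets"
  shows "hausdorff_dist A B \<le> e \<longleftrightarrow> (\<forall>b\<in>B. infdist b A \<le> e) \<and> (\<forall>a\<in>A. infdist a B \<le> e)"
proof -
  have "bdd_above ((\<lambda>b. infdist b A) ` B)" "bdd_above ((\<lambda>a. infdist a B) ` A)"
    using assms unfolding compact_convex_sets_def
    by (auto intro!: bounded_imp_bdd_above compact_imp_bounded
        compact_continuous_image continuous_intros)
  moreover have "A \<noteq> {}" "B \<noteq> {}"
    using assms by (auto simp: compact_convex_sets_def)
  ultimately show ?thesis
    using assms by (simp add: hausdorff_dist_def cSUP_le_iff)
qed

lemma hausdorff_dist_nonneg: "0 \<le> hausdorff_dist A B"
proof (cases "A \<in> compact_convex_sets \<and> B \<in> compact_convex_sets")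
  case True
  then obtain b where "b \<in> B" by (auto simp: compact_convex_sets_def)
  then have "infdist b A \<le> hausdorff_dist A B"
    using True hausdorff_dist_le_iff[of A B "hausdorff_dist A B"] by auto
  then show ?thesis
    using infdist_nonneg[of b A] by linarith
qed (auto simp: hausdorff_dist_def)

lemma Metric_space_hausdorff_dist:
  "Metric_space (compact_convex_sets :: (real ^ 'n) set set) hausdorff_dist"
proof
  fix A B C :: "(real ^ 'n) set"
  show "0 \<le> hausdorff_dist A B"
    by (rule hausdorff_dist_nonneg)
  show "hausdorff_dist A B = hausdorff_dist B A"
    by (auto simp: hausdorff_dist_def max.commute)
  assume A: "A \<in> compact_convex_sets" and B: "B \<in> compact_convex_sets"
  have closed: "A \<noteq> {}" "closed A" "B \<noteq> {}" "closed B"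
    using A B by (auto simp: compact_convex_sets_def compact_imp_closed)
  have le0: "infdist x S \<le> 0 \<longleftrightarrow> x \<in> S" if "closed S" "S \<noteq> {}" for x and S :: "(real ^ 'n) set"
    using that in_closed_iff_infdist_zero[of S x] infdist_nonneg[of x S] by auto
  have "hausdorff_dist A B = 0 \<longleftrightarrow> hausdorff_dist A B \<le> 0"
    using hausdorff_dist_nonneg[of A B] by linarith
  also have "\<dots> \<longleftrightarrow> A = B"
    using closed by (auto simp: hausdorff_dist_le_iff[OF A B] le0)
  finally show "hausdorff_dist A B = 0 \<longleftrightarrow> A = B" .
  assume C: "C \<in> compact_convex_sets"
  have tri: "infdist x S \<le> r + s"
    if "S \<in> compact_convex_sets" "T \<in> compact_convex_sets" "infdist x T \<le> s" "\<forall>t\<in>T. infdist t S \<le> r"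
    for x r s and S T :: "(real ^ 'n) set"
  proof -
    have "closed T" "T \<noteq> {}"
      using that(2) by (auto simp: compact_convex_sets_def compact_imp_closed)
    then obtain t where "t \<in> T" "infdist x T = dist x t"
      using infdist_attains_inf[of T x] by metis
    then show ?thesis
      using infdist_triangle[of x S t] that by force
  qed
  have AB: "\<forall>b\<in>B. infdist b A \<le> hausdorff_dist A B" "\<forall>a\<in>A. infdist a B \<le> hausdorff_dist A B"
    using hausdorff_dist_le_iff[OF A B, of "hausdorff_dist A B"] by auto
  have BC: "\<forall>c\<in>C. infdist c B \<le> hausdorff_dist B C" "\<forall>b\<in>B. infdist b C \<le> hausdorff_dist B C"
    using hausdorff_dist_le_iff[OF B C, of "hausdorff_dist B C"] by auto
  have "\<forall>c\<in>C. infdist c A \<le> hausdorff_dist A B + hausdorff_dist B C"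
    using tri[OF A B _ AB(1)] BC(1) by blast
  moreover have "\<forall>a\<in>A. infdist a C \<le> hausdorff_dist B C + hausdorff_dist A B"
    using tri[OF C B _ BC(2)] AB(2) by blast
  ultimately show "hausdorff_dist A C \<le> hausdorff_dist A B + hausdorff_dist B C"
    by (simp add: hausdorff_dist_le_iff[OF A C] add.commute)
qed

definition compact_convex_topology :: "(real ^ 'n) set topology" where
  "compact_convex_topology = Metric_space.mtopology compact_convex_sets hausdorff_dist"

lemma topspace_compact_convex_topology [simp]:
  "topspace compact_convex_topology = compact_convex_sets"
  by (simp add: compact_convex_topology_def
      Metric_space.topspace_mtopology[OF Metric_space_hausdorff_dist])


section \<open>The Euclidean group\<close>

definition euclidean_group :: "(real ^ 'n \<Rightarrow> real ^ 'n) monoid" where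
  "euclidean_group =
     \<lparr>carrier = {g. \<forall>x y. dist (g x) (g y) = dist x y}, mult = (\<circ>), one = id\<rparr>"

text \<open>The compact-open topology, which on isometries is also that of pointwise convergence.\<close>

definition euclidean_group_topology :: "(real ^ 'n \<Rightarrow> real ^ 'n) topology" where
  "euclidean_group_topology =
     topology_generated_by
       {{g \<in> carrier euclidean_group. g ` C \<subseteq> U} | C U. compact C \<and> open U}"

text \<open>\<^locale>\<open>group_action\<close> takes its values in \<^const>\<open>BijGroup\<close>, whose elements are extensional
  functions; hence the restriction.\<close>

definition compact_convex_action ::
    "(real ^ 'n \<Rightarrow> real ^ 'n) \<Rightarrow> (real ^ 'n) set \<Rightarrow> (real ^ 'n) set" where
  "compact_convex_action g = (\<lambda>K\<in>compact_convex_sets. g ` K)"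

end

theory Submission
  imports Defs
begin

text \<open>
  The stabiliser condition and the disjointness of the orbits say together that
  \<open>g K\<^sub>i \<mapsto> g y\<^sub>i\<close> is a well-defined equivariant map on the union of the finitely many given orbits,
  so an equivariant extension theorem is wanted. The extension is given by a formula in terms of
  the two metrics and the given map alone, so it commutes with everything that preserves these.

  Let \<open>S\<close> be the graph of the given map, the set of all pairs \<open>(g K\<^sub>i, g y\<^sub>i)\<close>. For a convex body \<open>L\<close>
  and a point \<open>z\<close> put
  \<open>F L z = sup {|z - v|\<^sup>2 - p (d L a) | (a, v) \<in> S}\<close>,
  where \<open>d\<close> is the Hausdorff metric and \<open>p\<close> is a suitable penalty function. As a supremum of
  functions \<open>|z|\<^sup>2 + affine\<close>, the function \<open>F L\<close> is strongly convex, hence has a unique minimiser,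
  and this is the value of the extension at \<open>L\<close>. Uniqueness yields equivariance. If \<open>p 0 = 0\<close> and
  \<open>|v - w|\<^sup>2 \<le> p (d a b)\<close> on \<open>S\<close>, then for \<open>(a, v) \<in> S\<close> one has \<open>F a v \<le> 0\<close> and \<open>F a z \<ge> |z - v|\<^sup>2\<close>, so
  the minimiser of \<open>F a\<close> is \<open>v\<close>. If moreover \<open>p\<close> is continuous and grows fast enough, only a
  bounded part of \<open>S\<close> matters for the supremum, \<open>F L\<close> depends on \<open>L\<close> uniformly on bounded sets of
  \<open>z\<close>, and strong convexity turns this into continuity of the minimiser. This is carried out
  in \<open>modulated_graph\<close> for a metric space and a Hilbert space.

  Such a \<open>p\<close> exists if for each \<open>e > 0\<close> some \<open>C\<close> satisfies \<open>|v - w|\<^sup>2 \<le> e + C (d a b)\<^sup>2\<close> on \<open>S\<close>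
  (\<open>orbit_graph_control\<close>). For large distances this holds because \<open>g y\<^sub>i\<close> stays within a fixed
  distance of \<open>g K\<^sub>i\<close>. For small distances it is uniform continuity of the given map, which follows
  from compactness (\<open>hausdorff_near_imp_near\<close>): isometries that move one fixed body close to another
  have a pointwise convergent subsequence, and the limit moves the one body onto the other.
\<close>

section \<open>Equivariant extension by minimising a strongly convex cost\<close>

lemma square_le_two_squares:
  fixes r s t :: real
  assumes "r \<le> s + t" "0 \<le> r" shows "r\<^sup>2 \<le> 2 * s\<^sup>2 + 2 * t\<^sup>2"
proof -
  have "r\<^sup>2 \<le> (s + t)\<^sup>2" using assms by (intro power_mono)
  also have "\<dots> = 2 * s\<^sup>2 + 2 * t\<^sup>2 - (s - t)\<^sup>2" by (simp add: power2_eq_square algebra_simps)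
  finally show ?thesis using zero_le_power2[of "s - t"] by linarith
qed

lemma dist_midpoint_square:
  fixes z w v :: "'c::real_inner"
  shows "(dist (midpoint z w) v)\<^sup>2 = ((dist z v)\<^sup>2 + (dist w v)\<^sup>2) / 2 - (dist z w)\<^sup>2 / 4"
proof -
  have "midpoint z w - v = (1 / 2) *\<^sub>R ((z - v) + (w - v))"
    by (simp add: midpoint_def algebra_simps flip: scaleR_2)
  then have "dist (midpoint z w) v = norm ((z - v) + (w - v)) / 2"
    by (simp only: dist_norm norm_scaleR)
  then have "(dist (midpoint z w) v)\<^sup>2 = (norm ((z - v) + (w - v)))\<^sup>2 / 4"
    by (simp only: power_divide) simp
  moreover have "dist z w = norm ((z - v) - (w - v))" by (simp add: dist_norm)
  ultimately show ?thesis
    unfolding dist_norm by (simp only:) (simp add: power2_norm_eq_inner inner_add inner_diff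
        inner_commute field_simps)
qed

text \<open>
  The set \<open>S\<close> is the graph of the partial map to be extended. The condition
  \<open>quadratic_control\<close> combines uniform continuity of this map (small \<open>e\<close>) with at most linear growth
  of the distance of values. With \<open>a = b\<close> and \<open>e\<close> tending to \<open>0\<close> it forces \<open>v = w\<close>, so \<open>S\<close> is
  single-valued.
\<close>

locale modulated_graph = Metric_space M d
  for M :: "'a set" and d +
  fixes S :: "('a \<times> 'b::{real_inner,complete_space}) set"
  assumes nonempty: "S \<noteq> {}"
    and base_in_M: "(a, v) \<in> S \<Longrightarrow> a \<in> M"
    and quadratic_control:
      "e > 0 \<Longrightarrow> \<exists>C\<ge>0. \<forall>(a, v)\<in>S. \<forall>(b, w)\<in>S. (dist v w)\<^sup>2 \<le> e + C * (d a b)\<^sup>2"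
begin

definition controls :: "real \<Rightarrow> real \<Rightarrow> bool" where
  "controls e C \<longleftrightarrow> e > 0 \<and> C \<ge> 0 \<and>
     (\<forall>(a, v)\<in>S. \<forall>(b, w)\<in>S. (dist v w)\<^sup>2 \<le> e + C * (d a b)\<^sup>2)"

text \<open>
  A modulus of continuity for the square of the distance of values. In the variable \<open>t\<^sup>2\<close> it is an
  infimum of affine functions with nonnegative coefficients, which makes it continuous,
  including at \<open>0\<close>.
\<close>

definition modulus :: "real \<Rightarrow> real" where
  "modulus t = (INF (e, C)\<in>{(e, C). controls e C}. e + C * t\<^sup>2)"

definition growth :: real where
  "growth = (SOME C. controls 1 C)"

text \<open>
  The quadratic term exceeds \<open>4 * growth * t\<^sup>2\<close>, which bounds the growth of \<open>(dist z v)\<^sup>2\<close>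
  in the distance \<open>t\<close> from \<open>x\<close> to the base point \<open>a\<close> of \<open>v\<close> (see \<open>gap_le\<close>).
\<close>

definition penalty :: "real \<Rightarrow> real" where
  "penalty t = modulus t + (4 * growth + 1) * t\<^sup>2"

definition gap :: "'a \<Rightarrow> 'b \<Rightarrow> 'a \<times> 'b \<Rightarrow> real" where
  "gap x z = (\<lambda>(a, v). (dist z v)\<^sup>2 - penalty (d x a))"

definition cost :: "'a \<Rightarrow> 'b \<Rightarrow> real" where
  "cost x z = (SUP p\<in>S. gap x z p)"

definition extension :: "'a \<Rightarrow> 'b" where
  "extension x = (SOME z. \<forall>w. cost x z \<le> cost x w)"

lemma controls_exists: "e > 0 \<Longrightarrow> \<exists>C. controls e C"
  using quadratic_control[of e] by (auto simp: controls_def)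

lemma controlsD:
  "controls e C \<Longrightarrow> (a, v) \<in> S \<Longrightarrow> (b, w) \<in> S \<Longrightarrow> (dist v w)\<^sup>2 \<le> e + C * (d a b)\<^sup>2"
  by (force simp: controls_def)

lemma controls_growth: "controls 1 growth"
  unfolding growth_def using controls_exists[of 1] by (simp add: someI_ex)

lemma growth_nonneg: "growth \<ge> 0"
  using controls_growth by (simp add: controls_def)

lemma modulus_le: "controls e C \<Longrightarrow> modulus t \<le> e + C * t\<^sup>2"
  unfolding modulus_def
  by (rule cINF_lower2[where x = "(e, C)"])
    (auto intro!: bdd_belowI2[where m = 0] simp: controls_def)

lemma le_modulusI: "(\<And>e C. controls e C \<Longrightarrow> r \<le> e + C * t\<^sup>2) \<Longrightarrow> r \<le> modulus t"
  unfolding modulus_def using controls_exists[of 1] by (intro cINF_greatest) auto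

lemma modulus_nonneg: "modulus t \<ge> 0"
  by (rule le_modulusI) (auto simp: controls_def)

lemma modulus_0 [simp]: "modulus 0 = 0"
proof (rule antisym[OF field_le_epsilon modulus_nonneg])
  fix e :: real assume "e > 0"
  then show "modulus 0 \<le> 0 + e"
    using controls_exists[of e] modulus_le[of e _ 0] by auto
qed

lemma dist_le_modulus: "(a, v) \<in> S \<Longrightarrow> (b, w) \<in> S \<Longrightarrow> (dist v w)\<^sup>2 \<le> modulus (d a b)"
  by (rule le_modulusI) (rule controlsD)

lemma modulus_lessD:
  assumes "modulus t < r"
  obtains e C where "controls e C" "e + C * t\<^sup>2 < r"
  using assms le_modulusI[of r t] by (meson not_less)

text \<open>
  Each function \<open>e + C * t\<^sup>2\<close> shrinks at most by the factor \<open>(s / t)\<^sup>2\<close> when \<open>t\<close> is decreased to \<open>s\<close>, and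
  an infimum inherits this. It is the lower half of continuity; the upper half holds for every
  infimum of continuous functions. At \<open>t = 0\<close> the statement is nonnegativity of \<open>modulus\<close>.
\<close>

lemma modulus_scale: "modulus t * min 1 ((s / t)\<^sup>2) \<le> modulus s"
proof (cases "t = 0")
  case False
  show ?thesis
  proof (rule le_modulusI)
    fix e C assume c: "controls e C"
    define m where "m = min 1 ((s / t)\<^sup>2)"
    have m: "0 \<le> m" "m \<le> 1" "m \<le> (s / t)\<^sup>2" by (auto simp: m_def)
    have "modulus t * m \<le> (e + C * t\<^sup>2) * m"
      using modulus_le[OF c] m by (intro mult_right_mono)
    also have "\<dots> = e * m + C * t\<^sup>2 * m" by (simp add: algebra_simps)
    also have "\<dots> \<le> e * 1 + C * t\<^sup>2 * (s / t)\<^sup>2"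
      using c m unfolding controls_def by (intro add_mono mult_left_mono) auto
    also have "\<dots> = e + C * s\<^sup>2" using False by (simp add: power_divide)
    finally show "modulus t * min 1 ((s / t)\<^sup>2) \<le> e + C * s\<^sup>2" by (simp add: m_def)
  qed
qed (simp add: modulus_nonneg)

lemma isCont_modulus: "isCont modulus t"
  unfolding isCont_def
proof (rule order_tendstoI)
  fix r assume r: "r < modulus t"
  have "((\<lambda>s. modulus t * min 1 ((s / t)\<^sup>2)) \<longlongrightarrow> modulus t * min 1 ((t / t)\<^sup>2)) (at t)"
    by (cases "t = 0") (simp, intro tendsto_intros)
  moreover have "modulus t * min 1 ((t / t)\<^sup>2) = modulus t"
    by (cases "t = 0") auto
  ultimately have "((\<lambda>s. modulus t * min 1 ((s / t)\<^sup>2)) \<longlongrightarrow> modulus t) (at t)" by (simp only:)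
  then have "eventually (\<lambda>s. r < modulus t * min 1 ((s / t)\<^sup>2)) (at t)"
    using r by (rule order_tendstoD)
  then show "eventually (\<lambda>s. r < modulus s) (at t)"
    by (rule eventually_mono) (use modulus_scale[of t] less_le_trans in blast)
next
  fix r assume "modulus t < r"
  then obtain e C where c: "controls e C" "e + C * t\<^sup>2 < r" by (rule modulus_lessD)
  have "((\<lambda>s. e + C * s\<^sup>2) \<longlongrightarrow> e + C * t\<^sup>2) (at t)" by (intro tendsto_intros)
  then have "eventually (\<lambda>s. e + C * s\<^sup>2 < r) (at t)" using c(2) by (rule order_tendstoD)
  then show "eventually (\<lambda>s. modulus s < r) (at t)"
    by (rule eventually_mono) (use modulus_le[OF c(1)] le_less_trans in blast)
qed

lemma continuous_penalty: "continuous_on A penalty"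
proof -
  have "isCont penalty t" for t
    unfolding penalty_def by (intro continuous_intros isCont_modulus)
  then show ?thesis by (simp add: continuous_at_imp_continuous_on)
qed

lemma penalty_0 [simp]: "penalty 0 = 0"
  by (simp add: penalty_def)

lemma dist_le_penalty:
  assumes "(a, v) \<in> S" "(b, w) \<in> S" shows "(dist v w)\<^sup>2 \<le> penalty (d a b)"
  using dist_le_modulus[OF assms] growth_nonneg by (simp add: penalty_def add_increasing2)

lemma penalty_le: "penalty t \<le> 1 + (5 * growth + 1) * t\<^sup>2"
  using modulus_le[OF controls_growth, of t] by (simp add: penalty_def algebra_simps)

text \<open>
  Base points far from \<open>x\<close> contribute little to the cost: the penalty beats the growth of the
  values by a full \<open>(d x a)\<^sup>2\<close>. This gives finiteness of the cost and later confines the relevant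
  base points to a bounded region.
\<close>

lemma gap_le:
  assumes "(b, w) \<in> S" "(a, v) \<in> S" "x \<in> M"
  shows "gap x z (a, v) \<le> 2 * (dist z w)\<^sup>2 + 2 + 4 * growth * (d x b)\<^sup>2 - (d x a)\<^sup>2"
proof -
  have M: "a \<in> M" "b \<in> M" using assms base_in_M by auto
  have "(dist z v)\<^sup>2 \<le> 2 * (dist z w)\<^sup>2 + 2 * (dist w v)\<^sup>2"
    by (intro square_le_two_squares dist_triangle) auto
  moreover have "(dist w v)\<^sup>2 \<le> 1 + growth * (d b a)\<^sup>2"
    using controlsD[OF controls_growth] assms by blast
  moreover have "growth * (d b a)\<^sup>2 \<le> growth * (2 * (d x b)\<^sup>2 + 2 * (d x a)\<^sup>2)"
    using triangle[of b x a] M assms(3) growth_nonneg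
    by (intro mult_left_mono square_le_two_squares) (auto simp: commute)
  ultimately show ?thesis
    using modulus_nonneg[of "d x a"] unfolding gap_def penalty_def
    by (simp add: algebra_simps)
qed

lemma bdd_above_gap:
  assumes "x \<in> M" shows "bdd_above (gap x z ` S)"
proof -
  obtain b w where bw: "(b, w) \<in> S" using nonempty by auto
  have "gap x z (a, v) \<le> 2 * (dist z w)\<^sup>2 + 2 + 4 * growth * (d x b)\<^sup>2" if "(a, v) \<in> S" for a v
    using gap_le[OF bw that assms, of z] by (rule order_trans) simp
  then show ?thesis by (intro bdd_aboveI2) auto
qed

lemma gap_le_cost: "x \<in> M \<Longrightarrow> p \<in> S \<Longrightarrow> gap x z p \<le> cost x z"
  unfolding cost_def by (intro cSUP_upper bdd_above_gap)

lemma cost_leI: "(\<And>a v. (a, v) \<in> S \<Longrightarrow> gap x z (a, v) \<le> r) \<Longrightarrow> cost x z \<le> r"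
  unfolding cost_def using nonempty by (intro cSUP_least) auto

lemma cost_le:
  assumes "(b, w) \<in> S" "x \<in> M"
  shows "cost x z \<le> 2 * (dist z w)\<^sup>2 + 2 + 4 * growth * (d x b)\<^sup>2"
  by (rule cost_leI) (use gap_le[OF assms(1) _ assms(2)] in \<open>smt (verit) zero_le_power2\<close>)

lemma cost_ge:
  assumes "(b, w) \<in> S" "x \<in> M"
  shows "(dist z w)\<^sup>2 - penalty (d x b) \<le> cost x z"
  using gap_le_cost[OF assms(2,1), of z] by (simp add: gap_def)

text \<open>
  Strong convexity. By the parallelogram law each \<open>gap x z p\<close> satisfies this with equality, and the
  defect \<open>(dist z w)\<^sup>2 / 4\<close> is the same for all \<open>p\<close>, so it survives the supremum.
\<close>

lemma cost_midpoint:
  assumes "x \<in> M"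
  shows "cost x (midpoint z w) \<le> (cost x z + cost x w) / 2 - (dist z w)\<^sup>2 / 4"
proof (rule cost_leI)
  fix a v assume p: "(a, v) \<in> S"
  have "gap x (midpoint z w) (a, v) = (gap x z (a, v) + gap x w (a, v)) / 2 - (dist z w)\<^sup>2 / 4"
    by (simp add: gap_def dist_midpoint_square field_simps)
  with gap_le_cost[OF assms p, of z] gap_le_cost[OF assms p, of w]
  show "gap x (midpoint z w) (a, v) \<le> (cost x z + cost x w) / 2 - (dist z w)\<^sup>2 / 4" by argo
qed

lemma closed_cost_sublevel:
  assumes "x \<in> M" shows "closed {z. cost x z \<le> r}"
proof -
  have "{z. cost x z \<le> r} = (\<Inter>(a, v)\<in>S. {z. (dist z v)\<^sup>2 - penalty (d x a) \<le> r})"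
  proof (intro equalityI subsetI)
    fix z assume "z \<in> {z. cost x z \<le> r}"
    then show "z \<in> (\<Inter>(a, v)\<in>S. {z. (dist z v)\<^sup>2 - penalty (d x a) \<le> r})"
      using order_trans[OF gap_le_cost[OF assms]] by (force simp: gap_def)
  next
    fix z assume "z \<in> (\<Inter>(a, v)\<in>S. {z. (dist z v)\<^sup>2 - penalty (d x a) \<le> r})"
    then show "z \<in> {z. cost x z \<le> r}" by (auto intro!: cost_leI simp: gap_def)
  qed
  moreover have "closed {z. (dist z v)\<^sup>2 - penalty (d x a) \<le> r}" for a v
    by (intro closed_Collect_le continuous_intros)
  ultimately show ?thesis by (auto intro!: closed_INT)
qed

text \<open>
  By strong convexity the sublevel sets above the infimum shrink to diameter zero, and they are
  closed, so completeness provides a common point.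
\<close>

lemma cost_minimum_exists:
  assumes x: "x \<in> M" shows "\<exists>z. \<forall>w. cost x z \<le> cost x w"
proof -
  obtain b w0 where bw: "(b, w0) \<in> S" using nonempty by auto
  have below: "bdd_below (range (cost x))"
    by (rule bdd_belowI2[where m = "- penalty (d x b)"])
      (use cost_ge[OF bw x] in \<open>smt (verit) zero_le_power2\<close>)
  define m where "m = (INF z. cost x z)"
  have m: "m \<le> cost x z" for z
    unfolding m_def using below by (intro cINF_lower) auto
  define A where "A n = {z. cost x z \<le> m + inverse (real (Suc n))}" for n
  obtain z where z: "\<And>n. z \<in> A n"
  proof (rule decreasing_closed_nest)
    show "closed (A n)" for n unfolding A_def by (rule closed_cost_sublevel[OF x])
    show "A n \<noteq> {}" for n
    proof -
      have "m < m + inverse (real (Suc n))" by simp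
      then obtain z where "cost x z < m + inverse (real (Suc n))"
        unfolding m_def using cINF_less_iff[OF _ below] by blast
      then show ?thesis unfolding A_def using less_imp_le by blast
    qed
    show "A n \<subseteq> A k" if "k \<le> n" for k n
    proof -
      have "inverse (real (Suc n)) \<le> inverse (real (Suc k))"
        using that by (intro le_imp_inverse_le) auto
      then show ?thesis unfolding A_def by (smt (verit) Collect_mono)
    qed
    show "\<exists>n. \<forall>z\<in>A n. \<forall>w\<in>A n. dist z w < e" if "e > 0" for e
    proof -
      obtain n where n: "inverse (real (Suc n)) < e\<^sup>2 / 4"
        using reals_Archimedean[of "e\<^sup>2 / 4"] \<open>e > 0\<close> by auto
      have "dist z w < e" if "z \<in> A n" "w \<in> A n" for z w
      proof (rule power2_less_imp_less)
        show "(dist z w)\<^sup>2 < e\<^sup>2"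
          using cost_midpoint[OF x, of z w] m[of "midpoint z w"] that n
          unfolding A_def mem_Collect_eq by argo
        show "0 \<le> e" using \<open>e > 0\<close> by simp
      qed
      then show ?thesis by blast
    qed
  qed blast
  have "cost x z \<le> m"
  proof (rule field_le_epsilon)
    fix e :: real assume "e > 0"
    then obtain n where "inverse (real (Suc n)) < e" using reals_Archimedean by blast
    then show "cost x z \<le> m + e" using z[of n] unfolding A_def mem_Collect_eq by linarith
  qed
  then show ?thesis using m by (meson order_trans)
qed

lemma cost_extension_le: "x \<in> M \<Longrightarrow> cost x (extension x) \<le> cost x w"
  unfolding extension_def using someI_ex[OF cost_minimum_exists] by blast

text \<open>
  The quantitative form of uniqueness of the minimiser: almost-minimisers are close to it.
\<close>

lemma dist_extension:
  assumes "x \<in> M"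
  shows "(dist (extension x) z)\<^sup>2 \<le> 2 * (cost x z - cost x (extension x))"
  using cost_midpoint[OF assms, of "extension x" z]
    cost_extension_le[OF assms, of "midpoint (extension x) z"] by argo

lemma extension_unique:
  assumes "x \<in> M" "\<And>w. cost x z \<le> cost x w" shows "extension x = z"
proof -
  have "(dist (extension x) z)\<^sup>2 \<le> 0"
    using dist_extension[OF assms(1), of z] assms(2)[of "extension x"] by argo
  then show ?thesis by simp
qed

lemma extension_extends:
  assumes "(a, v) \<in> S" shows "extension a = v"
proof (rule extension_unique)
  show a: "a \<in> M" using assms base_in_M by blast
  fix w
  have "cost a v \<le> 0"
  proof (rule cost_leI)
    fix b u assume "(b, u) \<in> S"
    then show "gap a v (b, u) \<le> 0" using dist_le_penalty[OF assms] by (simp add: gap_def)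
  qed
  also have "0 \<le> cost a w" using cost_ge[OF assms a, of w] a by (smt (verit) penalty_0 mdist_zero zero_le_power2)
  finally show "cost a v \<le> cost a w" .
qed

text \<open>
  The cost is built from the two metrics and \<open>S\<close>, hence is unchanged when \<open>x\<close> and \<open>z\<close> are moved by a
  symmetry of these data. Thus \<open>\<beta>\<close> carries minimisers to minimisers.
\<close>

lemma extension_equivariant:
  assumes \<alpha>: "\<And>x. x \<in> M \<Longrightarrow> \<alpha> x \<in> M" "\<And>x y. x \<in> M \<Longrightarrow> y \<in> M \<Longrightarrow> d (\<alpha> x) (\<alpha> y) = d x y"
    and \<beta>: "\<And>z w. dist (\<beta> z) (\<beta> w) = dist z w" "surj \<beta>"
    and S: "map_prod \<alpha> \<beta> ` S = S" and x: "x \<in> M"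
  shows "extension (\<alpha> x) = \<beta> (extension x)"
proof (rule extension_unique)
  have cost: "cost (\<alpha> x) (\<beta> z) = cost x z" for z
  proof -
    have "gap (\<alpha> x) (\<beta> z) (map_prod \<alpha> \<beta> p) = gap x z p" if "p \<in> S" for p
      using that base_in_M \<alpha>(2) x \<beta>(1) by (cases p) (auto simp: gap_def)
    then have "(\<lambda>p. gap (\<alpha> x) (\<beta> z) (map_prod \<alpha> \<beta> p)) ` S = gap x z ` S" by auto
    then show ?thesis unfolding cost_def by (subst S[symmetric]) (simp add: image_image)
  qed
  fix w
  obtain u where "w = \<beta> u" using \<beta>(2) by auto
  then show "cost (\<alpha> x) (\<beta> (extension x)) \<le> cost (\<alpha> x) w"
    using cost cost_extension_le[OF x] by simp
qed (use \<alpha> x in auto)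

text \<open>
  For base points near \<open>x\<close> uniform continuity of the penalty on a compact interval applies. For
  base points farther away than \<open>T\<close> the gap lies below the value that the single pair \<open>(b, w)\<close>
  guarantees for the cost at \<open>y\<close>, so they are irrelevant.
\<close>

lemma cost_locally_uniform:
  assumes bw: "(b, w) \<in> S" and e: "e > 0"
  obtains \<delta> where "\<delta> > 0" "\<And>x y z. \<lbrakk>x \<in> M; y \<in> M; d x y < \<delta>; d x b \<le> r; d y b \<le> r; dist z w \<le> R\<rbrakk>
      \<Longrightarrow> cost x z \<le> cost y z + e"
proof -
  \<comment> \<open>\<open>T\<close> is chosen such that \<open>d x a > T\<close>, hence \<open>(d x a)\<^sup>2 > T\<close>, makes the upper bound of the gap
    from \<open>gap_le\<close> smaller than the lower bound \<open>- penalty (d y b)\<close> of the cost at \<open>y\<close>. The interval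
    reaches to \<open>T + 1\<close> in order to contain \<open>d y a\<close> as well.\<close>
  define T where "T = 2 * R\<^sup>2 + 2 + 4 * growth * r\<^sup>2 + 1 + (5 * growth + 1) * r\<^sup>2"
  have T: "T \<ge> 1" using growth_nonneg by (simp add: T_def)
  have "uniformly_continuous_on {0..T + 1} penalty"
    by (intro compact_uniformly_continuous continuous_penalty) auto
  then obtain \<eta> where \<eta>: "\<eta> > 0" "\<And>s t. s \<in> {0..T + 1} \<Longrightarrow> t \<in> {0..T + 1} \<Longrightarrow> dist s t < \<eta> \<Longrightarrow>
      dist (penalty s) (penalty t) < e"
    using e unfolding uniformly_continuous_on_def by metis
  show thesis
  proof (rule that)
    show "min \<eta> 1 > 0" using \<eta> by simp
    fix x y z assume *: "x \<in> M" "y \<in> M" "d x y < min \<eta> 1" "d x b \<le> r" "d y b \<le> r" "dist z w \<le> R"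
    show "cost x z \<le> cost y z + e"
    proof (rule cost_leI)
      fix a v assume av: "(a, v) \<in> S"
      then have a: "a \<in> M" by (rule base_in_M)
      have close: "\<bar>d x a - d y a\<bar> \<le> d x y"
        using triangle[of x y a] triangle[of y x a] * a commute by fastforce
      show "gap x z (a, v) \<le> cost y z + e"
      proof (cases "d x a \<le> T")
        case True
        have "dist (penalty (d x a)) (penalty (d y a)) < e"
          using True close * by (intro \<eta>) (auto simp: dist_real_def)
        then have "gap x z (a, v) \<le> gap y z (a, v) + e" by (simp add: gap_def dist_real_def)
        then show ?thesis using gap_le_cost[OF *(2) av, of z] by linarith
      next
        case False
        have "T * 1 \<le> d x a * d x a" using False T by (intro mult_mono) auto
        moreover have "growth * (d x b)\<^sup>2 \<le> growth * r\<^sup>2" "(dist z w)\<^sup>2 \<le> R\<^sup>2"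
          "(5 * growth + 1) * (d y b)\<^sup>2 \<le> (5 * growth + 1) * r\<^sup>2"
          using * growth_nonneg by (auto intro!: mult_left_mono power_mono)
        ultimately have "gap x z (a, v) \<le> - penalty (d y b)"
          using gap_le[OF bw av *(1), of z] penalty_le[of "d y b"]
          by (simp add: T_def flip: power2_eq_square)
        also have "\<dots> \<le> cost y z"
          using cost_ge[OF bw *(2), of z] by (smt (verit) zero_le_power2)
        finally show ?thesis using e by linarith
      qed
    qed
  qed
qed

lemma extension_bounded:
  assumes bw: "(b, w) \<in> S" and x: "x \<in> M" and r: "d x b \<le> r"
  shows "(dist (extension x) w)\<^sup>2 \<le> 3 + (9 * growth + 1) * r\<^sup>2"
proof -
  have "(dist (extension x) w)\<^sup>2 \<le> 3 + (9 * growth + 1) * (d x b)\<^sup>2"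
    using cost_ge[OF bw x, of "extension x"] cost_extension_le[OF x, of w]
      cost_le[OF bw x, of w] penalty_le[of "d x b"] by (simp add: algebra_simps)
  also have "\<dots> \<le> 3 + (9 * growth + 1) * r\<^sup>2"
    using r growth_nonneg by (intro add_left_mono mult_left_mono power_mono) auto
  finally show ?thesis .
qed

text \<open>
  If \<open>y\<close> is near \<open>x\<close>, then the costs at \<open>x\<close> and \<open>y\<close> nearly agree on a ball containing both minimisers.
  Therefore the minimiser at \<open>y\<close> almost minimises the cost at \<open>x\<close> and is close to the minimiser at \<open>x\<close>.
\<close>

lemma extension_continuous:
  assumes x: "x \<in> M" and e: "e > 0"
  shows "\<exists>\<delta>>0. \<forall>y\<in>M. d x y < \<delta> \<longrightarrow> dist (extension x) (extension y) < e"
proof -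
  obtain b w where bw: "(b, w) \<in> S" using nonempty by auto
  then have b: "b \<in> M" by (rule base_in_M)
  define r where "r = d x b + 1"
  define R where "R = sqrt (3 + (9 * growth + 1) * r\<^sup>2)"
  have R: "dist (extension y) w \<le> R" if "y \<in> M" "d y b \<le> r" for y
    unfolding R_def using extension_bounded[OF bw that] by (rule real_le_rsqrt)
  obtain \<delta> where \<delta>: "\<delta> > 0" "\<And>x y z. \<lbrakk>x \<in> M; y \<in> M; d x y < \<delta>; d x b \<le> r; d y b \<le> r; dist z w \<le> R\<rbrakk>
      \<Longrightarrow> cost x z \<le> cost y z + e\<^sup>2 / 8"
    using cost_locally_uniform[OF bw, of "e\<^sup>2 / 8"] e by auto
  have "dist (extension x) (extension y) < e" if y: "y \<in> M" "d x y < min \<delta> 1" for y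
  proof (rule power2_less_imp_less)
    have br: "d x b \<le> r" "d y b \<le> r"
      using triangle[of y x b] y x b by (auto simp: r_def commute)
    have "cost x (extension y) \<le> cost y (extension y) + e\<^sup>2 / 8"
      using y x br R by (intro \<delta>) auto
    also have "cost y (extension y) \<le> cost y (extension x)"
      using y by (intro cost_extension_le)
    also have "cost y (extension x) \<le> cost x (extension x) + e\<^sup>2 / 8"
      using y x br R by (intro \<delta>) (auto simp: commute)
    finally have "cost x (extension y) - cost x (extension x) \<le> e\<^sup>2 / 4" by simp
    moreover have "e\<^sup>2 > 0" using e by simp
    ultimately show "(dist (extension x) (extension y))\<^sup>2 < e\<^sup>2"
      using dist_extension[OF x, of "extension y"] by argo
    show "0 \<le> e" using e by simp
  qed
  then show ?thesis using \<delta>(1) by (intro exI[of _ "min \<delta> 1"]) auto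
qed

lemma continuous_map_extension: "continuous_map mtopology euclidean extension"
proof -
  have "continuous_map mtopology Met_TC.mtopology extension"
    unfolding metric_continuous_map[OF Met_TC.Metric_space_axioms]
    using extension_continuous by simp metis
  then show ?thesis by simp
qed

end



section \<open>The Euclidean group as a topological group\<close>

lemma carrier_euclidean_group:
  "g \<in> carrier euclidean_group \<longleftrightarrow> (\<forall>x y. dist (g x) (g y) = dist x y)"
  by (simp add: euclidean_group_def)

lemma isometry_linear_part:
  fixes g :: "real ^ 'n \<Rightarrow> real ^ 'n"
  assumes "\<And>x y. dist (g x) (g y) = dist x y"
  shows "orthogonal_transformation (\<lambda>x. g x - g 0)"
  using assms by (simp add: orthogonal_transformation_isometry dist_norm)

lemma isometry_continuous:
  assumes "\<And>x y. dist (g x) (g y) = dist x y" shows "continuous_on A g"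
  using assms by (auto simp: continuous_on_iff)

lemma isometry_bij:
  fixes g :: "real ^ 'n \<Rightarrow> real ^ 'n"
  assumes "\<And>x y. dist (g x) (g y) = dist x y" shows "bij g"
proof (rule bijI)
  show "inj g" by (rule injI) (metis assms dist_eq_0_iff)
  show "surj g"
  proof (rule surjI)
    fix y
    show "g (inv_into UNIV (\<lambda>x. g x - g 0) (y - g 0)) = y"
      using surj_f_inv_f[OF orthogonal_transformation_surj[OF isometry_linear_part[OF assms]],
          of "y - g 0"] by simp
  qed
qed

lemma isometry_inv:
  fixes g :: "real ^ 'n \<Rightarrow> real ^ 'n"
  assumes "\<And>x y. dist (g x) (g y) = dist x y" shows "dist (inv_into UNIV g x) (inv_into UNIV g y) = dist x y"
  using assms isometry_bij[OF assms] by (metis bij_inv_eq_iff)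

lemma group_euclidean_group: "group (euclidean_group :: (real ^ 'n \<Rightarrow> real ^ 'n) monoid)"
proof (rule groupI)
  fix g :: "real ^ 'n \<Rightarrow> real ^ 'n"
  assume "g \<in> carrier euclidean_group"
  then have g: "dist (g x) (g y) = dist x y" for x y by (simp add: carrier_euclidean_group)
  have "inv_into UNIV g \<circ> g = id" using isometry_bij[OF g] by (simp add: bij_is_inj)
  moreover have "inv_into UNIV g \<in> carrier euclidean_group"
    using isometry_inv[OF g] by (simp add: carrier_euclidean_group)
  ultimately show "\<exists>h\<in>carrier euclidean_group. h \<otimes>\<^bsub>euclidean_group\<^esub> g = \<one>\<^bsub>euclidean_group\<^esub>"
    by (auto simp: euclidean_group_def)
qed (auto simp: euclidean_group_def)

lemma mult_euclidean_group [simp]: "g \<otimes>\<^bsub>euclidean_group\<^esub> h = g \<circ> h"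
  by (simp add: euclidean_group_def)

lemma inv_euclidean_group:
  fixes g :: "real ^ 'n \<Rightarrow> real ^ 'n"
  assumes "g \<in> carrier euclidean_group"
  shows "inv\<^bsub>euclidean_group\<^esub> g = inv_into UNIV g"
proof -
  interpret group "euclidean_group :: (real ^ 'n \<Rightarrow> real ^ 'n) monoid"
    by (rule group_euclidean_group)
  have g: "dist (g x) (g y) = dist x y" for x y
    using assms by (simp add: carrier_euclidean_group)
  have "inv_into UNIV g \<circ> g = id" using isometry_bij[OF g] by (simp add: bij_is_inj)
  moreover have "inv_into UNIV g \<in> carrier euclidean_group"
    using isometry_inv[OF g] by (simp add: carrier_euclidean_group)
  ultimately show ?thesis
    using assms by (intro inv_equality) (auto simp: euclidean_group_def)
qed

lemma topspace_euclidean_group_topology [simp]: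
  "topspace (euclidean_group_topology :: (real ^ 'n \<Rightarrow> real ^ 'n) topology) = carrier euclidean_group"
proof -
  have "carrier euclidean_group \<in>
      {{g \<in> carrier euclidean_group. g ` C \<subseteq> U} | (C :: (real ^ 'n) set) U. compact C \<and> open U}"
    by (rule CollectI, rule exI[of _ "{}"], rule exI[of _ "{}"]) auto
  then show ?thesis by (auto simp: euclidean_group_topology_def)
qed

lemma openin_euclidean_group_evaluation:
  assumes "open U"
  shows "openin euclidean_group_topology {g \<in> carrier euclidean_group. g x \<in> U}"
proof -
  have "{g \<in> carrier euclidean_group. g x \<in> U} = {g \<in> carrier euclidean_group. g ` {x} \<subseteq> U}" by auto
  then show ?thesis
    unfolding euclidean_group_topology_def using assms
    by (intro topology_generated_by_Basis) (blast intro: compact_insert[OF compact_empty])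
qed

text \<open>
  Two isometries that are close on a sufficiently fine finite net of a compact set are close on the
  whole set. Hence the compact-open topology is governed by evaluation at points.
\<close>

lemma isometries_close_on_compact:
  fixes C :: "(real ^ 'n) set"
  assumes "compact C" "e > 0"
  obtains N where "finite N"
    "\<And>g h x. \<lbrakk>g \<in> carrier euclidean_group; h \<in> carrier euclidean_group;
        \<forall>p\<in>N. dist (g p) (h p) < e / 3; x \<in> C\<rbrakk> \<Longrightarrow> dist (g x) (h x) < e"
proof -
  obtain N where N: "finite N" "C \<subseteq> (\<Union>p\<in>N. ball p (e / 3))"
    using assms compact_imp_seq_compact seq_compact_imp_totally_bounded
    by (metis divide_pos_pos zero_less_numeral)
  show thesis
  proof (rule that[OF N(1)])
    fix g h :: "real ^ 'n \<Rightarrow> real ^ 'n" and x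
    assume *: "g \<in> carrier euclidean_group" "h \<in> carrier euclidean_group"
      "\<forall>p\<in>N. dist (g p) (h p) < e / 3" "x \<in> C"
    then obtain p where p: "p \<in> N" "dist p x < e / 3" using N(2) by (auto simp: dist_commute)
    have "dist (g x) (g p) = dist x p" "dist (h p) (h x) = dist p x"
      using * by (auto simp: carrier_euclidean_group)
    moreover have "dist (g p) (h p) < e / 3" using * p by blast
    ultimately show "dist (g x) (h x) < e"
      using p(2) dist_triangle[of "g x" "h x" "g p"] dist_triangle[of "g p" "h x" "h p"]
      by (simp add: dist_commute)
  qed
qed

lemma euclidean_group_nbhd_compact:
  fixes g :: "real ^ 'n \<Rightarrow> real ^ 'n"
  assumes g: "g \<in> carrier euclidean_group" and C: "compact C" and e: "e > 0"
  obtains V where "openin euclidean_group_topology V" "g \<in> V"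
    "\<And>h x. h \<in> V \<Longrightarrow> x \<in> C \<Longrightarrow> dist (g x) (h x) < e"
proof -
  obtain N where N: "finite N"
    "\<And>g h x. \<lbrakk>g \<in> carrier euclidean_group; h \<in> carrier euclidean_group;
        \<forall>p\<in>N. dist (g p) (h p) < e / 3; x \<in> C\<rbrakk> \<Longrightarrow> dist (g x) (h x) < e"
    using isometries_close_on_compact[OF C e] by blast
  define V where "V = {h \<in> carrier euclidean_group. \<forall>p\<in>N. h p \<in> ball (g p) (e / 3)}"
  have V: "V = (\<Inter>p\<in>N. {h \<in> carrier euclidean_group. h p \<in> ball (g p) (e / 3)}) \<inter>
      topspace euclidean_group_topology"
    by (auto simp: V_def)
  show thesis
  proof (rule that)
    show "openin euclidean_group_topology V"
      unfolding V using N(1) by (intro openin_INT openin_euclidean_group_evaluation open_ball)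
    show "g \<in> V" using g e by (simp add: V_def)
    show "dist (g x) (h x) < e" if "h \<in> V" "x \<in> C" for h x
      using N(2)[OF g _ _ that(2), of h] that(1) by (simp add: V_def)
  qed
qed

text \<open>
  A map into the Euclidean group is continuous if it is pointwise continuous. This is what makes the
  continuity of composition and inversion easy to check.
\<close>

lemma continuous_map_into_euclidean_group:
  fixes \<phi> :: "'a \<Rightarrow> real ^ 'n \<Rightarrow> real ^ 'n"
  assumes \<phi>: "\<And>t. t \<in> topspace X \<Longrightarrow> \<phi> t \<in> carrier euclidean_group"
    and cont: "\<And>x. continuous_map X euclidean (\<lambda>t. \<phi> t x)"
  shows "continuous_map X euclidean_group_topology \<phi>"
  unfolding euclidean_group_topology_def continuous_on_generated_topo_iff
proof (intro conjI allI impI)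
  show "\<phi> ` topspace X \<subseteq> \<Union>{{g \<in> carrier euclidean_group. g ` C \<subseteq> U} | (C :: (real ^ 'n) set) U. compact C \<and> open U}"
    using \<phi> topspace_euclidean_group_topology
    unfolding euclidean_group_topology_def topology_generated_by_topspace by blast
  fix W
  assume "W \<in> {{g \<in> carrier euclidean_group. g ` C \<subseteq> U} | (C :: (real ^ 'n) set) U. compact C \<and> open U}"
  then obtain C U where W: "W = {g \<in> carrier euclidean_group. g ` C \<subseteq> U}"
    and C: "compact C" and U: "open U" by blast
  show "openin X (\<phi> -` W \<inter> topspace X)"
  proof (subst openin_subopen, intro ballI)
    fix t assume t: "t \<in> \<phi> -` W \<inter> topspace X"
    then have g: "\<phi> t \<in> carrier euclidean_group" and sub: "\<phi> t ` C \<subseteq> U" by (auto simp: W)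
    have "compact (\<phi> t ` C)"
      using g C by (intro compact_continuous_image isometry_continuous)
        (auto simp: carrier_euclidean_group)
    then obtain e where e: "e > 0" "(\<Union>y\<in>\<phi> t ` C. ball y e) \<subseteq> U"
      using compact_subset_open_imp_ball_epsilon_subset[OF _ U sub] by metis
    obtain N where N: "finite N"
      "\<And>g h x. \<lbrakk>g \<in> carrier euclidean_group; h \<in> carrier euclidean_group;
          \<forall>p\<in>N. dist (g p) (h p) < e / 3; x \<in> C\<rbrakk> \<Longrightarrow> dist (g x) (h x) < e"
      using isometries_close_on_compact[OF C e(1)] by blast
    define T where "T = (\<Inter>p\<in>N. {s \<in> topspace X. \<phi> s p \<in> ball (\<phi> t p) (e / 3)}) \<inter> topspace X"
    have "openin X T"
      unfolding T_def using N(1)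
      by (intro openin_INT openin_continuous_map_preimage[OF cont]) simp_all
    moreover have "t \<in> T" using t e by (auto simp: T_def)
    moreover have "T \<subseteq> \<phi> -` W \<inter> topspace X"
    proof
      fix s assume s: "s \<in> T"
      then have "\<phi> s \<in> carrier euclidean_group" using \<phi> by (auto simp: T_def)
      moreover have "\<phi> s x \<in> U" if "x \<in> C" for x
      proof -
        have "dist (\<phi> t x) (\<phi> s x) < e"
          using N(2)[OF g \<open>\<phi> s \<in> _\<close> _ that] s by (auto simp: T_def)
        then have "\<phi> s x \<in> (\<Union>y\<in>\<phi> t ` C. ball y e)" using that by auto
        then show ?thesis using e(2) by blast
      qed
      ultimately show "s \<in> \<phi> -` W \<inter> topspace X" using s by (auto simp: W T_def)
    qed
    ultimately show "\<exists>T. openin X T \<and> t \<in> T \<and> T \<subseteq> \<phi> -` W \<inter> topspace X" by blast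
  qed
qed

lemma continuous_map_into_metric_space:
  fixes f :: "'a \<Rightarrow> 'b::metric_space"
  shows "continuous_map X euclidean f \<longleftrightarrow>
    (\<forall>x\<in>topspace X. \<forall>e>0. \<exists>U. openin X U \<and> x \<in> U \<and> (\<forall>y\<in>U. dist (f x) (f y) < e))"
  using Met_TC.continuous_map_to_metric[of X f] by simp

lemma continuous_map_evaluation:
  "continuous_map (prod_topology euclidean_group_topology euclidean) euclidean
     (\<lambda>(g, x). g x :: real ^ 'n)"
  unfolding continuous_map_into_metric_space
proof (intro ballI allI impI)
  fix p :: "(real ^ 'n \<Rightarrow> real ^ 'n) \<times> (real ^ 'n)" and e :: real
  assume "p \<in> topspace (prod_topology euclidean_group_topology euclidean)" and e: "e > 0"
  then obtain g x where p: "p = (g, x)" and g: "g \<in> carrier euclidean_group" by (cases p) auto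
  obtain V where V: "openin euclidean_group_topology V" "g \<in> V"
      "\<And>h y. h \<in> V \<Longrightarrow> y \<in> {x} \<Longrightarrow> dist (g y) (h y) < e / 2"
    using euclidean_group_nbhd_compact[OF g, of "{x}" "e / 2"] e by auto
  have "dist (g x) (h y) < e" if "h \<in> V" "y \<in> ball x (e / 2)" for h y
  proof -
    have "h \<in> carrier euclidean_group" using openin_subset[OF V(1)] that by auto
    then have "dist (h x) (h y) = dist x y" by (simp add: carrier_euclidean_group)
    then show ?thesis
      using V(3)[OF that(1), of x] that(2) dist_triangle[of "g x" "h y" "h x"] by simp
  qed
  then show "\<exists>U. openin (prod_topology euclidean_group_topology euclidean) U \<and> p \<in> U \<and>
      (\<forall>q\<in>U. dist (case p of (g, x) \<Rightarrow> g x) (case q of (g, x) \<Rightarrow> g x) < e)"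
    using V e by (intro exI[of _ "V \<times> ball x (e / 2)"]) (auto simp: p openin_prod_Times_iff)
qed

lemma topological_group_euclidean_group:
  "topological_group (euclidean_group :: (real ^ 'n \<Rightarrow> real ^ 'n) monoid) euclidean_group_topology"
  unfolding topological_group_def
proof (intro conjI)
  let ?T = "euclidean_group_topology :: (real ^ 'n \<Rightarrow> real ^ 'n) topology"
  show "group (euclidean_group :: (real ^ 'n \<Rightarrow> real ^ 'n) monoid)" by (rule group_euclidean_group)
  show "topspace ?T = carrier euclidean_group" by simp
  have at: "continuous_map ?T euclidean (\<lambda>g. g x)" for x
    using continuous_map_compose[OF _ continuous_map_evaluation,
        of ?T "\<lambda>g. (g, x)"] by (simp add: comp_def continuous_map_pairwise)
  show "continuous_map (prod_topology ?T ?T) ?T (\<lambda>(g, h). g \<otimes>\<^bsub>euclidean_group\<^esub> h)"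
  proof (rule continuous_map_into_euclidean_group)
    show "(case p of (g, h) \<Rightarrow> g \<otimes>\<^bsub>euclidean_group\<^esub> h) \<in> carrier euclidean_group"
      if "p \<in> topspace (prod_topology ?T ?T)" for p
      using that by (auto simp: carrier_euclidean_group)
    fix x
    have "continuous_map (prod_topology ?T ?T) (prod_topology ?T euclidean) (\<lambda>p. (fst p, snd p x))"
      using continuous_map_compose[OF continuous_map_snd at, of ?T x]
      by (simp add: continuous_map_paired continuous_map_fst comp_def)
    from continuous_map_compose[OF this continuous_map_evaluation]
    show "continuous_map (prod_topology ?T ?T) euclidean
        (\<lambda>p. (case p of (g, h) \<Rightarrow> g \<otimes>\<^bsub>euclidean_group\<^esub> h) x)"
      by (simp add: comp_def case_prod_unfold)
  qed
  show "continuous_map ?T ?T (\<lambda>g. inv\<^bsub>euclidean_group\<^esub> g)"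
  proof (rule continuous_map_into_euclidean_group)
    show "inv\<^bsub>euclidean_group\<^esub> g \<in> carrier euclidean_group" if "g \<in> topspace ?T" for g
      using that group.inv_closed[OF group_euclidean_group] by auto
    fix x :: "real ^ 'n"
    show "continuous_map ?T euclidean (\<lambda>g. (inv\<^bsub>euclidean_group\<^esub> g) x)"
      unfolding continuous_map_into_metric_space
    proof (intro ballI allI impI)
      fix g and e :: real
      assume "g \<in> topspace ?T" and e: "e > 0"
      then have g: "g \<in> carrier euclidean_group" by simp
      obtain V where V: "openin ?T V" "g \<in> V"
          "\<And>h y. h \<in> V \<Longrightarrow> y \<in> {inv_into UNIV g x} \<Longrightarrow> dist (g y) (h y) < e"
        using euclidean_group_nbhd_compact[OF g, of "{inv_into UNIV g x}" e] e by auto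
      have "dist ((inv\<^bsub>euclidean_group\<^esub> g) x) ((inv\<^bsub>euclidean_group\<^esub> h) x) < e" if "h \<in> V" for h
      proof -
        have h: "h \<in> carrier euclidean_group" using openin_subset[OF V(1)] that by auto
        \<comment> \<open>As \<open>h\<close> is an isometry, the two inverses differ at \<open>x\<close> as much as \<open>h\<close> and \<open>g\<close> differ at the
          single point \<open>inv_into UNIV g x\<close>.\<close>
        have "dist (h (inv_into UNIV g x)) (h (inv_into UNIV h x)) = dist (inv_into UNIV g x) (inv_into UNIV h x)"
          using h by (simp add: carrier_euclidean_group)
        moreover have "g (inv_into UNIV g x) = x" "h (inv_into UNIV h x) = x"
          using isometry_bij g h unfolding carrier_euclidean_group
          by (metis bij_inv_eq_iff)+
        ultimately show ?thesis
          using V(3)[OF that, of "inv_into UNIV g x"] by (simp add: inv_euclidean_group g h dist_commute)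
      qed
      then show "\<exists>U. openin ?T U \<and> g \<in> U \<and>
          (\<forall>h\<in>U. dist ((inv\<^bsub>euclidean_group\<^esub> g) x) ((inv\<^bsub>euclidean_group\<^esub> h) x) < e)"
        using V by blast
    qed
  qed
qed

section \<open>The actions on points and on compact convex sets\<close>

lemma group_actionI:
  assumes "group G"
    and "\<And>g x. g \<in> carrier G \<Longrightarrow> x \<in> E \<Longrightarrow> \<phi> g x \<in> E"
    and "\<And>g. g \<in> carrier G \<Longrightarrow> \<phi> g \<in> extensional E"
    and "\<And>g h x. g \<in> carrier G \<Longrightarrow> h \<in> carrier G \<Longrightarrow> x \<in> E \<Longrightarrow> \<phi> (g \<otimes>\<^bsub>G\<^esub> h) x = \<phi> g (\<phi> h x)"
    and "\<And>x. x \<in> E \<Longrightarrow> \<phi> \<one>\<^bsub>G\<^esub> x = x"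
  shows "group_action G E \<phi>"
proof -
  interpret group G by fact
  have bij: "bij_betw (\<phi> g) E E" if g: "g \<in> carrier G" for g
  proof (rule bij_betw_byWitness[where f' = "\<phi> (inv\<^bsub>G\<^esub> g)"])
    show "\<forall>x\<in>E. \<phi> (inv\<^bsub>G\<^esub> g) (\<phi> g x) = x"
      using g assms(4)[of "inv\<^bsub>G\<^esub> g" g] assms(5) by (simp add: l_inv)
    show "\<forall>x\<in>E. \<phi> g (\<phi> (inv\<^bsub>G\<^esub> g) x) = x"
      using g assms(4)[of g "inv\<^bsub>G\<^esub> g"] assms(5) by (simp add: r_inv)
  qed (use g assms(2) in auto)
  then have Bij: "\<phi> g \<in> Bij E" if "g \<in> carrier G" for g
    using that assms(3) by (simp add: Bij_def)
  have "\<phi> (g \<otimes>\<^bsub>G\<^esub> h) = compose E (\<phi> g) (\<phi> h)" if "g \<in> carrier G" "h \<in> carrier G" for g h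
    using that assms(4)[of g h] assms(3)[of "g \<otimes>\<^bsub>G\<^esub> h"]
    by (intro extensionalityI[of _ E]) (auto simp: compose_def extensional_def)
  then have "\<phi> \<in> hom G (BijGroup E)"
    using Bij by (auto simp: hom_def BijGroup_def)
  then show ?thesis
    by (simp add: group_action_def group_hom_def group_hom_axioms_def group_BijGroup assms(1))
qed

lemma isometry_image_compact_convex:
  fixes g :: "real ^ 'n \<Rightarrow> real ^ 'n"
  assumes g: "g \<in> carrier euclidean_group" and K: "K \<in> compact_convex_sets"
  shows "g ` K \<in> compact_convex_sets"
proof -
  have g': "dist (g x) (g y) = dist x y" for x y using g by (simp add: carrier_euclidean_group)
  have "g ` K = (+) (g 0) ` (\<lambda>x. g x - g 0) ` K" by (simp add: image_image)
  moreover have "convex ((+) (g 0) ` (\<lambda>x. g x - g 0) ` K)"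
    using K isometry_linear_part[OF g'] unfolding compact_convex_sets_def
    by (auto intro!: convex_translation convex_linear_image orthogonal_transformation_linear)
  moreover have "compact (g ` K)"
    using K by (auto intro!: compact_continuous_image isometry_continuous g' simp: compact_convex_sets_def)
  ultimately show ?thesis using K by (simp add: compact_convex_sets_def)
qed

lemma hausdorff_dist_leI:
  assumes "A \<in> compact_convex_sets" "B \<in> compact_convex_sets"
    and "\<And>a. a \<in> A \<Longrightarrow> \<exists>b\<in>B. dist a b \<le> e" "\<And>b. b \<in> B \<Longrightarrow> \<exists>a\<in>A. dist a b \<le> e"
  shows "hausdorff_dist A B \<le> e"
  unfolding hausdorff_dist_le_iff[OF assms(1,2)]
  using assms(3,4) by (metis infdist_le2 dist_commute)

lemma hausdorff_dist_witness:
  assumes A: "A \<in> compact_convex_sets" and B: "B \<in> compact_convex_sets" and a: "a \<in> A"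
  obtains b where "b \<in> B" "dist a b \<le> hausdorff_dist A B"
proof -
  have "infdist a B \<le> hausdorff_dist A B"
    using hausdorff_dist_le_iff[OF A B, of "hausdorff_dist A B"] a by simp
  moreover obtain b where "b \<in> B" "infdist a B = dist a b"
    using infdist_attains_inf[of B a] B by (auto simp: compact_convex_sets_def compact_imp_closed)
  ultimately show thesis using that by simp
qed

lemma hausdorff_dist_isometry:
  fixes g :: "real ^ 'n \<Rightarrow> real ^ 'n"
  assumes g: "g \<in> carrier euclidean_group"
    and A: "A \<in> compact_convex_sets" and B: "B \<in> compact_convex_sets"
  shows "hausdorff_dist (g ` A) (g ` B) = hausdorff_dist A B"
proof -
  have "infdist (g x) (g ` S) = infdist x S" for x S
    using g by (simp add: infdist_def image_image carrier_euclidean_group)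
  then show ?thesis
    using assms isometry_image_compact_convex[OF g] by (simp add: hausdorff_dist_def image_image)
qed

lemma hausdorff_dist_two_isometries:
  assumes "g \<in> carrier euclidean_group" "h \<in> carrier euclidean_group" "K \<in> compact_convex_sets"
    and "\<And>x. x \<in> K \<Longrightarrow> dist (g x) (h x) \<le> e"
  shows "hausdorff_dist (g ` K) (h ` K) \<le> e"
  using assms by (intro hausdorff_dist_leI isometry_image_compact_convex) auto

interpretation hausdorff: Metric_space "compact_convex_sets :: (real ^ 'n) set set" hausdorff_dist
  by (rule Metric_space_hausdorff_dist)

lemma G_space_euclidean:
  "G_space euclidean_group euclidean_group_topology (euclidean :: (real ^ 'n) topology) (\<lambda>g x. g x)"
  unfolding G_space_def
  using topological_group_euclidean_group continuous_map_evaluation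
  by (auto intro!: group_actionI group_euclidean_group) (simp add: euclidean_group_def)

lemma G_space_compact_convex:
  "G_space (euclidean_group :: (real ^ 'n \<Rightarrow> real ^ 'n) monoid) euclidean_group_topology
     compact_convex_topology compact_convex_action"
  unfolding G_space_def
proof (intro conjI topological_group_euclidean_group)
  let ?T = "euclidean_group_topology :: (real ^ 'n \<Rightarrow> real ^ 'n) topology"
  show "group_action (euclidean_group :: (real ^ 'n \<Rightarrow> real ^ 'n) monoid)
      (topspace compact_convex_topology) compact_convex_action"
    by (rule group_actionI) (auto simp: group_euclidean_group compact_convex_action_def
        isometry_image_compact_convex image_image, auto simp: euclidean_group_def)
  show "continuous_map (prod_topology ?T compact_convex_topology) compact_convex_topology
      (\<lambda>(g, K). compact_convex_action g K)"
    unfolding compact_convex_topology_def hausdorff.continuous_map_to_metric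
  proof (intro ballI allI impI)
    fix p :: "(real ^ 'n \<Rightarrow> real ^ 'n) \<times> (real ^ 'n) set" and e :: real
    assume "p \<in> topspace (prod_topology ?T hausdorff.mtopology)" and e: "e > 0"
    then obtain g K where p: "p = (g, K)" and g: "g \<in> carrier euclidean_group"
      and K: "K \<in> compact_convex_sets" by (cases p) auto
    obtain V where V: "openin ?T V" "g \<in> V"
        "\<And>h x. h \<in> V \<Longrightarrow> x \<in> K \<Longrightarrow> dist (g x) (h x) < e / 3"
      using euclidean_group_nbhd_compact[OF g, of K "e / 3"] e K
      by (auto simp: compact_convex_sets_def)
    have "h ` L \<in> hausdorff.mball (g ` K) e"
      if h: "h \<in> V" and L: "L \<in> hausdorff.mball K (e / 3)" for h L
    proof -
      have L': "L \<in> compact_convex_sets" "hausdorff_dist K L < e / 3" using L by auto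
      have h': "h \<in> carrier euclidean_group" using openin_subset[OF V(1)] h by auto
      have "hausdorff_dist (g ` K) (h ` K) \<le> e / 3"
        using V(3)[OF h] by (intro hausdorff_dist_two_isometries g h' K) (simp add: less_imp_le)
      moreover have "hausdorff_dist (h ` K) (h ` L) < e / 3"
        using hausdorff_dist_isometry[OF h' K L'(1)] L'(2) by simp
      ultimately show ?thesis
        using hausdorff.triangle[of "g ` K" "h ` K" "h ` L"] e
          isometry_image_compact_convex[OF g K] isometry_image_compact_convex[OF h' K]
          isometry_image_compact_convex[OF h' L'(1)] by simp
    qed
    then show "\<exists>U. openin (prod_topology ?T hausdorff.mtopology) U \<and> p \<in> U \<and>
        (\<forall>q\<in>U. (case q of (g, K) \<Rightarrow> compact_convex_action g K)
           \<in> hausdorff.mball (case p of (g, K) \<Rightarrow> compact_convex_action g K) e)"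
      using V e K
      by (intro exI[of _ "V \<times> hausdorff.mball K (e / 3)"])
        (auto simp: p openin_prod_Times_iff compact_convex_action_def simp del: hausdorff.in_mball
          dest: hausdorff.in_mball[THEN iffD1])
  qed
qed



section \<open>Uniform control along orbits\<close>

text \<open>
  The Euclidean group is proper: an isometry is determined by the image of \<open>0\<close> and the images of the
  unit vectors relative to it. The latter are bounded automatically, so bounding the former is
  enough for Bolzano--Weierstrass.
\<close>

lemma isometries_subsequence:
  fixes g :: "nat \<Rightarrow> real ^ 'n \<Rightarrow> real ^ 'n"
  assumes g: "\<And>m. g m \<in> carrier euclidean_group" and bdd: "bounded (range (\<lambda>m. g m 0))"
  obtains h r where "h \<in> carrier euclidean_group" "strict_mono r"
    "\<And>x. (\<lambda>m. g (r m) x) \<longlonglongrightarrow> h x"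
proof -
  define A where "A m = (\<chi> i. g m (axis i 1) - g m 0)" for m
  have orth: "orthogonal_transformation (\<lambda>x. g m x - g m 0)" for m
    using g by (intro isometry_linear_part) (simp add: carrier_euclidean_group)
  have expand: "g m x = g m 0 + (\<Sum>i\<in>UNIV. x $ i *\<^sub>R A m $ i)" for m x
  proof -
    interpret linear "\<lambda>x. g m x - g m 0"
      using orth by (rule orthogonal_transformation_linear)
    have "g m (\<Sum>i\<in>UNIV. x $ i *\<^sub>R axis i 1) - g m 0 = (\<Sum>i\<in>UNIV. x $ i *\<^sub>R A m $ i)"
      unfolding sum by (simp add: scale A_def)
    then show ?thesis
      using basis_expansion[of x] by (simp add: scalar_mult_eq_scaleR algebra_simps)
  qed
  have "norm (A m) \<le> real CARD('n)" for m
  proof -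
    have "norm (A m $ i) = 1" for i
      using orthogonal_transformation_norm[OF orth, of m "axis i 1"] by (simp add: A_def)
    then show ?thesis
      using L2_set_le_sum[of UNIV "\<lambda>i. norm (A m $ i)"] by (simp add: norm_vec_def)
  qed
  then have "bounded (range A)" by (intro boundedI) auto
  moreover have "range (\<lambda>m. (g m 0, A m)) \<subseteq> range (\<lambda>m. g m 0) \<times> range A" by auto
  ultimately have "bounded (range (\<lambda>m. (g m 0, A m)))"
    using bdd bounded_Times bounded_subset by blast
  then obtain l r where r: "strict_mono r" and l: "((\<lambda>m. (g m 0, A m)) \<circ> r) \<longlonglongrightarrow> l"
    using bounded_imp_convergent_subsequence by blast
  define h where "h x = fst l + (\<Sum>i\<in>UNIV. x $ i *\<^sub>R snd l $ i)" for x
  have "(\<lambda>m. g (r m) 0) \<longlonglongrightarrow> fst l" "(\<lambda>m. A (r m)) \<longlonglongrightarrow> snd l"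
    using tendsto_fst[OF l] tendsto_snd[OF l] by (simp_all add: comp_def)
  then have lim: "(\<lambda>m. g (r m) x) \<longlonglongrightarrow> h x" for x
    unfolding h_def by (subst expand) (intro tendsto_intros)
  have "dist (h x) (h y) = dist x y" for x y
  proof (rule LIMSEQ_unique)
    show "(\<lambda>m. dist (g (r m) x) (g (r m) y)) \<longlonglongrightarrow> dist (h x) (h y)"
      by (intro tendsto_dist lim)
    show "(\<lambda>m. dist (g (r m) x) (g (r m) y)) \<longlonglongrightarrow> dist x y"
      using g by (simp add: carrier_euclidean_group)
  qed
  then have "h \<in> carrier euclidean_group" by (simp add: carrier_euclidean_group)
  then show thesis using r lim that by blast
qed

text \<open>
  Otherwise there are isometries bringing \<open>L\<close> arbitrarily close to \<open>K\<close> but keeping \<open>w\<close> away from \<open>y\<close>.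
  They move \<open>0\<close> by a bounded amount, and a limit of a subsequence maps \<open>L\<close> onto \<open>K\<close> but \<open>w\<close> not to \<open>y\<close>.
  For bodies from different orbits such a limit is impossible, whatever \<open>y\<close> and \<open>w\<close> are.
\<close>

lemma hausdorff_near_imp_near:
  fixes K L :: "(real ^ 'n) set"
  assumes K: "K \<in> compact_convex_sets" and L: "L \<in> compact_convex_sets" and e: "e > 0"
    and compat: "\<And>g. g \<in> carrier euclidean_group \<Longrightarrow> g ` L = K \<Longrightarrow> g w = y"
  shows "\<exists>\<delta>>0. \<forall>g\<in>carrier euclidean_group. hausdorff_dist K (g ` L) < \<delta> \<longrightarrow> dist y (g w) < e"
proof (rule ccontr)
  assume contr: "\<not> ?thesis"
  have "\<exists>g. g \<in> carrier euclidean_group \<and> hausdorff_dist K (g ` L) < inverse (real (Suc m)) \<and>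
      \<not> dist y (g w) < e" for m
  proof -
    have "inverse (real (Suc m)) > 0" by simp
    then show ?thesis using contr by blast
  qed
  then obtain g where g: "\<And>m. g m \<in> carrier euclidean_group"
      "\<And>m. hausdorff_dist K (g m ` L) < inverse (real (Suc m))" "\<And>m. \<not> dist y (g m w) < e"
    by metis
  obtain l where l: "l \<in> L" using L by (auto simp: compact_convex_sets_def)
  have "bounded K" using K compact_imp_bounded by (auto simp: compact_convex_sets_def)
  then obtain B where B: "\<And>k. k \<in> K \<Longrightarrow> norm k \<le> B" unfolding bounded_iff by blast
  have "norm (g m 0) \<le> B + 1 + norm l" for m
  proof -
    have gL: "g m ` L \<in> compact_convex_sets" using g(1) L by (rule isometry_image_compact_convex)
    obtain k where k: "k \<in> K" "dist (g m l) k \<le> hausdorff_dist (g m ` L) K"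
      using hausdorff_dist_witness[OF gL K] l by blast
    have "inverse (real (Suc m)) \<le> 1" by (simp add: divide_simps)
    then have "dist (g m l) k \<le> 1"
      using k(2) g(2)[of m] hausdorff.commute[of "g m ` L" K] by linarith
    moreover have "dist (g m 0) (g m l) = norm l"
      using g(1) by (simp add: carrier_euclidean_group)
    ultimately show ?thesis
      using B[OF k(1)] dist_triangle[of "g m 0" 0 "g m l"] dist_triangle[of "g m l" 0 k] by simp
  qed
  then have "bounded (range (\<lambda>m. g m 0))" by (intro boundedI) auto
  then obtain h r where h: "h \<in> carrier euclidean_group" and r: "strict_mono r"
      and lim: "\<And>x. (\<lambda>m. g (r m) x) \<longlonglongrightarrow> h x"
    using isometries_subsequence[of g] g(1) by blast
  have hL: "h ` L \<in> compact_convex_sets" using h L by (rule isometry_image_compact_convex)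
  have "hausdorff_dist K (h ` L) \<le> 0"
  proof (rule field_le_epsilon)
    fix \<epsilon> :: real assume \<epsilon>: "\<epsilon> > 0"
    obtain N where N: "finite N"
        "\<And>g h x. \<lbrakk>g \<in> carrier euclidean_group; h \<in> carrier euclidean_group;
          \<forall>p\<in>N. dist (g p) (h p) < \<epsilon> / 2 / 3; x \<in> L\<rbrakk> \<Longrightarrow> dist (g x) (h x) < \<epsilon> / 2"
      using isometries_close_on_compact[of L "\<epsilon> / 2"] L \<epsilon> by (auto simp: compact_convex_sets_def)
    have "eventually (\<lambda>m. \<forall>p\<in>N. dist (g (r m) p) (h p) < \<epsilon> / 2 / 3) sequentially"
      using N(1) \<epsilon> by (intro eventually_ball_finite ballI tendstoD[OF lim]) simp_all
    moreover have "eventually (\<lambda>m. inverse (real (Suc (r m))) < \<epsilon> / 2) sequentially"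
      using LIMSEQ_subseq_LIMSEQ[OF LIMSEQ_inverse_real_of_nat r] \<epsilon>
      by (intro order_tendstoD(2)) (auto simp: comp_def)
    ultimately have "eventually (\<lambda>m. (\<forall>p\<in>N. dist (g (r m) p) (h p) < \<epsilon> / 2 / 3) \<and>
        inverse (real (Suc (r m))) < \<epsilon> / 2) sequentially"
      by (rule eventually_conj)
    then obtain m where m: "\<forall>p\<in>N. dist (g (r m) p) (h p) < \<epsilon> / 2 / 3"
        "inverse (real (Suc (r m))) < \<epsilon> / 2"
      by (metis (no_types, lifting) eventually_happens sequentially_bot)
    have gL: "g (r m) ` L \<in> compact_convex_sets"
      using g(1) L by (rule isometry_image_compact_convex)
    have "hausdorff_dist (g (r m) ` L) (h ` L) \<le> \<epsilon> / 2"
      using N(2)[OF g(1) h m(1)] by (intro hausdorff_dist_two_isometries g(1) h L) (rule less_imp_le)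
    then show "hausdorff_dist K (h ` L) \<le> 0 + \<epsilon>"
      using hausdorff.triangle[OF K gL hL] g(2)[of "r m"] m(2) by linarith
  qed
  then have "h ` L = K"
    using hausdorff.zero[OF K hL] hausdorff.nonneg[of K "h ` L"] by auto
  then have "h w = y" using compat h by blast
  then have "eventually (\<lambda>m. dist (g (r m) w) y < e) sequentially"
    using lim[of w] e by (auto dest: tendstoD)
  then obtain m where "dist (g (r m) w) y < e"
    by (metis (no_types, lifting) eventually_happens sequentially_bot)
  then show False using g(3)[of "r m"] by (simp add: dist_commute)
qed

lemma dist_le_hausdorff_dist:
  fixes K L :: "(real ^ 'n) set"
  assumes K: "K \<in> compact_convex_sets" and L: "L \<in> compact_convex_sets"
    and g: "g \<in> carrier euclidean_group"
    and y: "\<And>k. k \<in> K \<Longrightarrow> dist y k \<le> R" and w: "\<And>l. l \<in> L \<Longrightarrow> dist w l \<le> R"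
  shows "dist y (g w) \<le> 2 * R + hausdorff_dist K (g ` L)"
proof -
  obtain k where k: "k \<in> K" using K by (auto simp: compact_convex_sets_def)
  obtain l where l: "l \<in> L" "dist k (g l) \<le> hausdorff_dist K (g ` L)"
    using hausdorff_dist_witness[OF K isometry_image_compact_convex[OF g L] k] by blast
  have "dist (g l) (g w) \<le> R" using w[OF l(1)] g by (simp add: carrier_euclidean_group dist_commute)
  then show ?thesis
    using y[OF k] l(2) dist_triangle[of y "g w" k] dist_triangle[of k "g w" "g l"] by linarith
qed

text \<open>
  Let \<open>d\<close> be the least of the finitely many thresholds that \<open>hausdorff_near_imp_near\<close> provides for the
  bound \<open>sqrt e\<close>. Distances below \<open>d\<close> are covered by the summand \<open>e\<close>. Above \<open>d\<close>, the constant in the linear bound of \<open>dist_le_hausdorff_dist\<close> is absorbed in a multiple of the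
  distance.
\<close>

lemma orbit_graph_control:
  fixes K :: "'i \<Rightarrow> (real ^ 'n) set"
  assumes I: "finite I" and K: "\<And>i. i \<in> I \<Longrightarrow> K i \<in> compact_convex_sets"
    and compat: "\<And>i j g. \<lbrakk>i \<in> I; j \<in> I; g \<in> carrier euclidean_group; g ` K j = K i\<rbrakk> \<Longrightarrow> g (y j) = y i"
    and e: "e > 0"
  shows "\<exists>C\<ge>0. \<forall>i\<in>I. \<forall>j\<in>I. \<forall>g\<in>carrier euclidean_group.
    (dist (y i) (g (y j)))\<^sup>2 \<le> e + C * (hausdorff_dist (K i) (g ` K j))\<^sup>2"
proof -
  have "\<forall>p\<in>I \<times> I. \<exists>\<delta>>0. \<forall>g\<in>carrier euclidean_group.
      hausdorff_dist (K (fst p)) (g ` K (snd p)) < \<delta> \<longrightarrow> dist (y (fst p)) (g (y (snd p))) < sqrt e"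
    using e by (intro ballI hausdorff_near_imp_near K compat) auto
  then obtain \<delta> where \<delta>: "\<And>p. p \<in> I \<times> I \<Longrightarrow> \<delta> p > 0 \<and> (\<forall>g\<in>carrier euclidean_group.
      hausdorff_dist (K (fst p)) (g ` K (snd p)) < \<delta> p \<longrightarrow> dist (y (fst p)) (g (y (snd p))) < sqrt e)"
    by metis
  have "\<forall>i\<in>I. \<exists>R. \<forall>k\<in>K i. dist (y i) k \<le> R"
    using K compact_imp_bounded unfolding compact_convex_sets_def
    by (metis (no_types, lifting) bounded_any_center mem_Collect_eq)
  then obtain R where R: "\<And>i k. i \<in> I \<Longrightarrow> k \<in> K i \<Longrightarrow> dist (y i) k \<le> R i" by metis
  define d where "d = Min (insert 1 (\<delta> ` (I \<times> I)))"
  define D where "D = Max (insert 0 (R ` I))"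
  have d: "d > 0" "\<And>p. p \<in> I \<times> I \<Longrightarrow> d \<le> \<delta> p"
    using I \<delta> by (auto simp: d_def)
  have D: "D \<ge> 0" "\<And>i. i \<in> I \<Longrightarrow> R i \<le> D" using I by (auto simp: D_def)
  show ?thesis
  proof (intro exI[of _ "(2 * D / d + 1)\<^sup>2"] conjI ballI)
    show "(2 * D / d + 1)\<^sup>2 \<ge> 0" by simp
    fix i j and g :: "real ^ 'n \<Rightarrow> real ^ 'n"
    assume i: "i \<in> I" and j: "j \<in> I" and g: "g \<in> carrier euclidean_group"
    define t where "t = hausdorff_dist (K i) (g ` K j)"
    show "(dist (y i) (g (y j)))\<^sup>2 \<le> e + (2 * D / d + 1)\<^sup>2 * (hausdorff_dist (K i) (g ` K j))\<^sup>2"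
    proof (cases "t < d")
      case True
      then have "dist (y i) (g (y j)) < sqrt e"
        using \<delta>[of "(i, j)"] d(2)[of "(i, j)"] i j g by (auto simp: t_def)
      then have "(dist (y i) (g (y j)))\<^sup>2 \<le> (sqrt e)\<^sup>2" by (intro power_mono) auto
      then show ?thesis using e by (simp add: add_increasing2)
    next
      case False
      have "dist (y i) (g (y j)) \<le> 2 * D + t"
        unfolding t_def using R[OF i] R[OF j] D(2)[OF i] D(2)[OF j]
        by (intro dist_le_hausdorff_dist K i j g) (meson order_trans)+
      also have "2 * D \<le> 2 * D / d * t"
        using False d(1) D(1) mult_left_mono[of d t D] by (simp add: field_simps)
      finally have "dist (y i) (g (y j)) \<le> (2 * D / d + 1) * t" by (simp add: algebra_simps)
      then have "(dist (y i) (g (y j)))\<^sup>2 \<le> ((2 * D / d + 1) * t)\<^sup>2" by (intro power_mono) auto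
      then show ?thesis using e by (simp add: t_def power_mult_distrib)
    qed
  qed
qed

definition orbit_graph where
  "orbit_graph I K y = {(g ` K i, g (y i)) | g i. g \<in> carrier euclidean_group \<and> i \<in> I}"

lemma orbit_graph_invariant:
  fixes g :: "real ^ 'n \<Rightarrow> real ^ 'n"
  assumes g: "g \<in> carrier euclidean_group"
  shows "map_prod ((`) g) g ` orbit_graph I K y = orbit_graph I K y"
proof -
  have sub: "map_prod ((`) g) g ` orbit_graph I K y \<subseteq> orbit_graph I K y"
    if g: "g \<in> carrier euclidean_group" for g :: "real ^ 'n \<Rightarrow> real ^ 'n"
  proof
    fix p assume "p \<in> map_prod ((`) g) g ` orbit_graph I K y"
    then obtain h i where h: "h \<in> carrier euclidean_group" "i \<in> I" "p = (g ` h ` K i, g (h (y i)))"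
      by (auto simp: orbit_graph_def)
    then have "g \<circ> h \<in> carrier euclidean_group" "p = ((g \<circ> h) ` K i, (g \<circ> h) (y i))"
      using g by (auto simp: carrier_euclidean_group image_comp)
    then show "p \<in> orbit_graph I K y" using h(2) unfolding orbit_graph_def by blast
  qed
  have g': "dist (g x) (g y) = dist x y" for x y using g by (simp add: carrier_euclidean_group)
  have "inv_into UNIV g \<in> carrier euclidean_group"
    using isometry_inv[OF g'] by (simp add: carrier_euclidean_group)
  from image_mono[OF sub[OF this], of "map_prod ((`) g) g"]
  have "orbit_graph I K y \<subseteq> map_prod ((`) g) g ` orbit_graph I K y"
    using isometry_bij[OF g']
    by (simp add: image_image map_prod_def case_prod_unfold bij_is_surj surj_f_inv_f)
  then show ?thesis using sub[OF g] by blast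
qed

section \<open>Extension from finitely many orbits\<close>

text \<open>
  The condition \<open>compat\<close> says that \<open>orbit_graph I K y\<close> is the graph of a map. The isometries of the two
  spaces reduce the control of a general pair of graph points to the case where one of them is
  \<open>(K i, y i)\<close>, which is \<open>orbit_graph_control\<close>.
\<close>

lemma equivariant_extension:
  fixes K :: "'i \<Rightarrow> (real ^ 'n) set"
  assumes I: "finite I" "I \<noteq> {}" and K: "\<And>i. i \<in> I \<Longrightarrow> K i \<in> compact_convex_sets"
    and compat: "\<And>i j g. \<lbrakk>i \<in> I; j \<in> I; g \<in> carrier euclidean_group; g ` K j = K i\<rbrakk> \<Longrightarrow> g (y j) = y i"
  shows "\<exists>f. G_map euclidean_group compact_convex_topology compact_convex_action euclidean (\<lambda>g x. g x) f \<and>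
    (\<forall>i\<in>I. f (K i) = y i)"
proof -
  interpret modulated_graph "compact_convex_sets" hausdorff_dist "orbit_graph I K y"
  proof
    show "orbit_graph I K y \<noteq> {}"
      using I(2) by (auto simp: orbit_graph_def carrier_euclidean_group)
    show "a \<in> compact_convex_sets" if "(a, v) \<in> orbit_graph I K y" for a v
      using that K isometry_image_compact_convex by (auto simp: orbit_graph_def)
    fix e :: real assume "e > 0"
    then have "\<exists>C\<ge>0. \<forall>i\<in>I. \<forall>j\<in>I. \<forall>g\<in>carrier euclidean_group.
        (dist (y i) (g (y j)))\<^sup>2 \<le> e + C * (hausdorff_dist (K i) (g ` K j))\<^sup>2"
      by (intro orbit_graph_control I K compat)
    then obtain C where C: "C \<ge> 0" "\<And>i j g. \<lbrakk>i \<in> I; j \<in> I; g \<in> carrier euclidean_group\<rbrakk> \<Longrightarrow>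
        (dist (y i) (g (y j)))\<^sup>2 \<le> e + C * (hausdorff_dist (K i) (g ` K j))\<^sup>2"
      by blast
    have "(dist (g (y i)) (h (y j)))\<^sup>2 \<le> e + C * (hausdorff_dist (g ` K i) (h ` K j))\<^sup>2"
      if "i \<in> I" "j \<in> I" and g: "g \<in> carrier euclidean_group" and h: "h \<in> carrier euclidean_group"
      for i j g h
    proof -
      have g': "dist (g x) (g y) = dist x y" for x y using g by (simp add: carrier_euclidean_group)
      define k where "k = inv_into UNIV g \<circ> h"
      have k: "k \<in> carrier euclidean_group"
        using isometry_inv[OF g'] h by (simp add: k_def carrier_euclidean_group)
      have gk: "g (k x) = h x" for x
        using isometry_bij[OF g'] by (simp add: k_def bij_is_surj surj_f_inv_f)
      have "dist (g (y i)) (h (y j)) = dist (y i) (k (y j))"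
        using g'[of "y i" "k (y j)"] by (simp add: gk)
      moreover have "hausdorff_dist (g ` K i) (h ` K j) = hausdorff_dist (K i) (k ` K j)"
        using hausdorff_dist_isometry[OF g K isometry_image_compact_convex[OF k K], of i j] that
        by (simp add: gk image_image)
      ultimately show ?thesis using C(2)[OF that(1,2) k] by simp
    qed
    then show "\<exists>C\<ge>0. \<forall>(a, v)\<in>orbit_graph I K y. \<forall>(b, w)\<in>orbit_graph I K y.
        (dist v w)\<^sup>2 \<le> e + C * (hausdorff_dist a b)\<^sup>2"
      using C(1) by (intro exI[of _ C]) (auto simp: orbit_graph_def)
  qed
  have "G_map euclidean_group compact_convex_topology compact_convex_action euclidean (\<lambda>g x. g x) extension"
    unfolding G_map_def
  proof (intro conjI ballI)
    show "continuous_map compact_convex_topology euclidean extension"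
      using continuous_map_extension by (simp add: compact_convex_topology_def)
    fix g :: "real ^ 'n \<Rightarrow> real ^ 'n" and L :: "(real ^ 'n) set"
    assume g: "g \<in> carrier euclidean_group" and "L \<in> topspace compact_convex_topology"
    then have L: "L \<in> compact_convex_sets" by simp
    have g': "dist (g x) (g y) = dist x y" for x y using g by (simp add: carrier_euclidean_group)
    have "extension (g ` L) = g (extension L)"
      by (intro extension_equivariant isometry_image_compact_convex hausdorff_dist_isometry
          orbit_graph_invariant g L g' bij_is_surj isometry_bij)
    then show "extension (compact_convex_action g L) = g (extension L)"
      using L by (simp add: compact_convex_action_def)
  qed
  moreover have "extension (K i) = y i" if "i \<in> I" for i
  proof (rule extension_extends)
    have "(id ` K i, id (y i)) \<in> orbit_graph I K y"
      using that unfolding orbit_graph_def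
      by (intro CollectI exI[of _ id] exI[of _ i]) (auto simp: carrier_euclidean_group)
    then show "(K i, y i) \<in> orbit_graph I K y" by simp
  qed
  ultimately show ?thesis by blast
qed

theorem theorem4p3:
  shows "G_finite_extension_property
     (euclidean_group :: (real ^ 'n \<Rightarrow> real ^ 'n) monoid) euclidean_group_topology
     compact_convex_topology compact_convex_action
     (euclidean :: (real ^ 'n) topology) (\<lambda>g x. g x)"
  unfolding G_finite_extension_property_def
proof (intro conjI allI impI G_space_compact_convex G_space_euclidean)
  fix k :: nat and x :: "nat \<Rightarrow> (real ^ 'n) set" and y :: "nat \<Rightarrow> real ^ 'n"
  let ?E = "euclidean_group :: (real ^ 'n \<Rightarrow> real ^ 'n) monoid"
  assume *: "(\<forall>i\<in>{1..k}. x i \<in> topspace compact_convex_topology \<and> y i \<in> topspace euclidean) \<and>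
    (\<forall>i\<in>{1..k}. stabilizer ?E compact_convex_action (x i) \<subseteq> stabilizer ?E (\<lambda>g x. g x) (y i)) \<and>
    (\<forall>i\<in>{1..k}. \<forall>j\<in>{1..k}. i \<noteq> j \<longrightarrow>
      orbit ?E compact_convex_action (x i) \<inter> orbit ?E compact_convex_action (x j) = {})"
  show "\<exists>f. G_map ?E compact_convex_topology compact_convex_action euclidean (\<lambda>g x. g x) f \<and>
      (\<forall>i\<in>{1..k}. f (x i) = y i)"
  proof (cases "k = 0")
    case True
    \<comment> \<open>No values are prescribed, but an equivariant map is still needed. One comes from
      prescribing the value \<open>0\<close> at \<open>{0}\<close>, as every isometry that maps \<open>{0}\<close> onto itself fixes \<open>0\<close>.\<close>
    have "\<exists>f. G_map ?E compact_convex_topology compact_convex_action euclidean (\<lambda>g x. g x) f \<and>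
        (\<forall>i\<in>{()}. f {0} = 0)"
      by (rule equivariant_extension) (auto simp: compact_convex_sets_def)
    then show ?thesis using True by auto
  next
    case False
    have x: "x i \<in> compact_convex_sets" if "i \<in> {1..k}" for i using * that by auto
    show ?thesis
    proof (rule equivariant_extension)
      show "{1..k} \<noteq> {}" using False by auto
      fix i j and g :: "real ^ 'n \<Rightarrow> real ^ 'n"
      assume i: "i \<in> {1..k}" and j: "j \<in> {1..k}" and g: "g \<in> carrier ?E" and eq: "g ` x j = x i"
      have act: "compact_convex_action g (x j) = x i" using x[OF j] eq by (simp add: compact_convex_action_def)
      have "x i \<in> orbit ?E compact_convex_action (x j)"
        using act g unfolding orbit_def by force
      moreover have "x i \<in> orbit ?E compact_convex_action (x i)"
        unfolding orbit_def using x[OF i]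
        by (intro CollectI exI[of _ id]) (simp add: compact_convex_action_def carrier_euclidean_group)
      ultimately have "i = j" using * i j by blast
      then have "g \<in> stabilizer ?E compact_convex_action (x j)"
        using act g by (simp add: stabilizer_def)
      then have "g \<in> stabilizer ?E (\<lambda>g x. g x) (y j)" using * j by blast
      then show "g (y j) = y i" using \<open>i = j\<close> by (simp add: stabilizer_def)
    qed (use x in auto)
  qed
qed

end
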